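(* For every integer $d\ge0$, $\mathcal{SMF}_d=\{\pi\in\mathcal{SMF}_0:\pi\text{ does not contain }\mathfrak{s}_d\}$.
   Context: All sequences are finite words of positive integers. For an integer $d\ge 0$, an index $i$ of $\alpha=a_1\ldots a_n$ is a $d$-ascent if $i=1$, or $i\ge 2$ and $a_i>a_{i-1}-d$; $\mathrm{asc}_d\alpha$ is the number of $d$-ascents, and $\mathrm{asc}=\mathrm{asc}_0$ (ordinary ascents, where the first position always counts). $\alpha$ is a $d$-ascent sequence if $a_i\le1+\mathrm{asc}_d(a_1\ldots a_{i-1})$ for all $i$; $A_d$ is the set of these. For a word $\alpha$ and index $j$, $M(\alpha,j)$ adds $1$ to every $a_i$ with $i<j$ and $a_i\ge a_j$; $M(\alpha,j_1,\dots,j_k)=M(M(\alpha,j_1,\dots,j_{k-1}),j_k)$; $\mathrm{hat}_d(\alpha)=M(\alpha,j_1,\dots,j_k)$ with $j_1<\dots<j_k$ the $d$-ascents of $\alpha$. $\tilde{A}_d=\{\alpha\in A_d:\mathrm{hat}_d(\alpha)=\alpha\}$. A Cayley permutation of length $n$ is a word $\alpha$ of length $n$ whose set of values is $[k]$ for some $k$. For such $\alpha$, the Burge transpose $\gamma(\alpha)$ is the permutation of $[n]$ obtained by listing, for $j=1,2,\dots,k$ in turn, the positions $i$ with $a_i=j$ in decreasing order (equivalently, transposing the biword $\binom{12\ldots n}{\alpha}$: flip each column and sort columns by top entry, with weakly decreasing bottom entries among equal tops, and take the bottom row). Every element of $\tilde A_d$ is a Cayley permutation. The $d$-Fishburn permutations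 corresponding to self-modified $d$-ascent sequences are $\mathcal{SMF}_d=\Phi_d(\tilde{A}_d)$, where $\Phi_d=\gamma\circ\mathrm{hat}_d$ is the standard bijection from $A_d$ to $d$-Fishburn permutations; since elements of $\tilde A_d$ are fixed by $\mathrm{hat}_d$, $\mathcal{SMF}_d=\gamma(\tilde{A}_d)$. A permutation $\pi=p_1\ldots p_n$ contains $\mathfrak{s}_d$ if there are indices $i<j$ with $p_i=p_j+1$ and $\mathrm{asc}(p_ip_{i+1}\ldots p_j)\le d$. *)

theory Defs
  imports Main
begin

text \<open>
  Words are lists of natural numbers (positivity of the entries is part of \<open>asc_seqs\<close>), and their
  indices are list indices, hence counted from 0. Only the letters of the permutation
  \<open>burge \<alpha>\<close>, which are positions of \<open>\<alpha>\<close>, are counted from 1.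
\<close>

text \<open>The condition \<open>a\<^sub>i > a\<^sub>i\<^sub>-\<^sub>1 - d\<close> is written additively, since subtraction truncates.\<close>

definition d_ascents :: "nat \<Rightarrow> nat list \<Rightarrow> nat set" where
  "d_ascents d \<alpha> = {i. i < length \<alpha> \<and> (i = 0 \<or> \<alpha> ! i + d > \<alpha> ! (i - 1))}"

definition asc :: "nat \<Rightarrow> nat list \<Rightarrow> nat" where
  "asc d \<alpha> = card (d_ascents d \<alpha>)"

definition asc_seqs :: "nat \<Rightarrow> nat list set" where
  "asc_seqs d = {\<alpha>. \<forall>i < length \<alpha>. 1 \<le> \<alpha> ! i \<and> \<alpha> ! i \<le> 1 + asc d (take i \<alpha>)}"

definition M :: "nat list \<Rightarrow> nat \<Rightarrow> nat list" where
  "M \<alpha> j = map (\<lambda>i. if i < j \<and> \<alpha> ! i \<ge> \<alpha> ! j then \<alpha> ! i + 1 else \<alpha> ! i) [0..<length \<alpha>]"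

text \<open>The list of positions is that of the d-ascents of the original word \<open>\<alpha>\<close>.\<close>

definition hat :: "nat \<Rightarrow> nat list \<Rightarrow> nat list" where
  "hat d \<alpha> = foldl M \<alpha> (sorted_list_of_set (d_ascents d \<alpha>))"

definition self_modified :: "nat \<Rightarrow> nat list set" where
  "self_modified d = {\<alpha> \<in> asc_seqs d. hat d \<alpha> = \<alpha>}"

text \<open>
  The Burge transpose is only used for Cayley permutations, where
  \<open>sorted_list_of_set (set \<alpha>)\<close> is the list \<open>1, 2, \<dots>, k\<close> of all values.
\<close>

definition burge :: "nat list \<Rightarrow> nat list" where
  "burge \<alpha> = concat (map (\<lambda>j. rev (map Suc (filter (\<lambda>i. \<alpha> ! i = j) [0..<length \<alpha>])))
                        (sorted_list_of_set (set \<alpha>)))"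

definition \<Phi> :: "nat \<Rightarrow> nat list \<Rightarrow> nat list" where
  "\<Phi> d = burge \<circ> hat d"

definition SMF :: "nat \<Rightarrow> nat list set" where
  "SMF d = \<Phi> d ` self_modified d"

text \<open>
  \<open>take (Suc j - i) (drop i \<pi>)\<close> is the factor \<open>p\<^sub>i \<dots> p\<^sub>j\<close>, both ends included; its first
  letter always counts as an ascent.
\<close>

definition contains_s :: "nat \<Rightarrow> nat list \<Rightarrow> bool" where
  "contains_s d \<pi> \<longleftrightarrow>
     (\<exists>i j. i < j \<and> j < length \<pi> \<and> \<pi> ! i = \<pi> ! j + 1 \<and> asc 0 (take (Suc j - i) (drop i \<pi>)) \<le> d)"

end

theory Submission
  imports Defs
begin

text \<open>
  A word is fixed by \<open>hat d\<close> iff each of its \<open>d\<close>-ascents is a strict left-to-right maximum. Hence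
  the self-modified \<open>d\<close>-ascent sequences are the restricted growth functions in which every letter
  is either a strict left-to-right maximum or smaller than its predecessor by at least \<open>d\<close>. In the Burge transpose of
  a restricted growth function, the positions carrying the same value form a decreasing run, and
  there is an ascent exactly where one value is followed by the next one. So for
  \<open>a\<^sub>p\<^sub>+\<^sub>1 \<le> a\<^sub>p\<close> the factor from \<open>p + 1\<close> to \<open>p\<close> has
  \<open>1 + a\<^sub>p - a\<^sub>p\<^sub>+\<^sub>1\<close> ascents, which is at most \<open>d\<close> iff the condition on \<open>d\<close> fails at \<open>p\<close>.
\<close>

section \<open>Counting ascents along prefixes\<close>

lemma asc_snoc:
  "asc d (xs @ [x]) = asc d xs + (if xs = [] \<or> x + d > last xs then 1 else 0)"
proof -
  have "d_ascents d (xs @ [x]) =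
      d_ascents d xs \<union> (if xs = [] \<or> x + d > last xs then {length xs} else {})"
    by (cases xs rule: rev_cases) (auto simp: d_ascents_def nth_append less_Suc_eq)
  moreover have "finite (d_ascents d xs)" "length xs \<notin> d_ascents d xs"
    by (auto simp: d_ascents_def)
  ultimately show ?thesis
    by (auto simp: asc_def)
qed

lemma asc_take_Suc:
  assumes "i < length \<alpha>"
  shows "asc d (take (Suc i) \<alpha>) = asc d (take i \<alpha>) + (if i \<in> d_ascents d \<alpha> then 1 else 0)"
proof -
  have "last (take i \<alpha>) = \<alpha> ! (i - 1)" if "i \<noteq> 0"
    using that assms by (cases i) (auto simp: take_Suc_conv_app_nth)
  then show ?thesis
    using assms by (auto simp: take_Suc_conv_app_nth asc_snoc d_ascents_def)
qed

section \<open>Fixed points of \<open>hat\<close>\<close>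

lemma length_M [simp]: "length (M \<alpha> j) = length \<alpha>"
  by (simp add: M_def)

lemma M_increasing: "i < length \<alpha> \<Longrightarrow> \<alpha> ! i \<le> M \<alpha> j ! i"
  by (simp add: M_def)

lemma M_fixed_iff:
  assumes "j < length \<alpha>"
  shows "M \<alpha> j = \<alpha> \<longleftrightarrow> (\<forall>i<j. \<alpha> ! i < \<alpha> ! j)"
proof -
  have "M \<alpha> j = \<alpha> \<longleftrightarrow> (\<forall>i<length \<alpha>. \<not> (i < j \<and> \<alpha> ! j \<le> \<alpha> ! i))"
    by (simp add: list_eq_iff_nth_eq, simp add: M_def) blast
  also have "\<dots> \<longleftrightarrow> (\<forall>i<j. \<alpha> ! i < \<alpha> ! j)"
    using assms by (meson less_trans not_le)
  finally show ?thesis .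
qed

lemma length_foldl_M [simp]: "length (foldl M \<alpha> js) = length \<alpha>"
  by (induction js arbitrary: \<alpha>) auto

lemma foldl_M_increasing: "i < length \<alpha> \<Longrightarrow> \<alpha> ! i \<le> foldl M \<alpha> js ! i"
proof (induction js arbitrary: \<alpha>)
  case (Cons j js)
  then show ?case
    using M_increasing[of i \<alpha> j] Cons.IH[of "M \<alpha> j"] by (simp add: order_trans)
qed simp

text \<open>No step lowers an entry, so an increase made by one \<open>M\<close> is never undone by
  the later ones.\<close>

lemma foldl_M_fixed_iff: "foldl M \<alpha> js = \<alpha> \<longleftrightarrow> (\<forall>j\<in>set js. M \<alpha> j = \<alpha>)"
proof (induction js)
  case (Cons j js)
  have "M \<alpha> j = \<alpha>" if "foldl M (M \<alpha> j) js = \<alpha>"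
  proof (rule nth_equalityI)
    fix i assume "i < length (M \<alpha> j)"
    then show "M \<alpha> j ! i = \<alpha> ! i"
      using M_increasing[of i \<alpha> j] foldl_M_increasing[of i "M \<alpha> j" js] that by simp
  qed simp
  then show ?case
    using Cons.IH by auto
qed simp

lemma hat_fixed_iff: "hat d \<alpha> = \<alpha> \<longleftrightarrow> (\<forall>j\<in>d_ascents d \<alpha>. \<forall>i<j. \<alpha> ! i < \<alpha> ! j)"
proof -
  have "finite (d_ascents d \<alpha>)"
    by (simp add: d_ascents_def)
  then show ?thesis
    by (auto simp: hat_def foldl_M_fixed_iff M_fixed_iff d_ascents_def)
qed

section \<open>Self-modified sequences as restricted growth functions\<close>

text \<open>Equivalent to bounding each letter by one plus the maximum of the earlier ones; this
  form directly supplies the earlier occurrences of smaller values.\<close>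

definition rgf :: "nat list \<Rightarrow> bool" where
  "rgf \<alpha> \<longleftrightarrow> (\<forall>i<length \<alpha>. 1 \<le> \<alpha> ! i \<and> {1..<\<alpha> ! i} \<subseteq> set (take i \<alpha>))"

lemma set_take_Suc: "i < length \<alpha> \<Longrightarrow> set (take (Suc i) \<alpha>) = insert (\<alpha> ! i) (set (take i \<alpha>))"
  by (simp add: take_Suc_conv_app_nth)

text \<open>A \<open>d\<close>-ascent exceeds all earlier values but by at most one, so it adds
  exactly the next value; any other letter is at most its predecessor and repeats an old value. The
  two alternatives in \<open>bound\<close> serve the two directions of
  \<open>self_modified_iff\<close>.\<close>

lemma set_take_eq_asc:
  assumes max: "\<forall>j\<in>d_ascents d \<alpha>. \<forall>i<j. \<alpha> ! i < \<alpha> ! j"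
    and bound: "\<alpha> \<in> asc_seqs d \<or> rgf \<alpha>"
    and "i \<le> length \<alpha>"
  shows "set (take i \<alpha>) = {1..asc d (take i \<alpha>)}"
  using \<open>i \<le> length \<alpha>\<close>
proof (induction i)
  case 0
  then show ?case by (simp add: asc_def d_ascents_def)
next
  case (Suc i)
  let ?m = "asc d (take i \<alpha>)"
  have i: "i < length \<alpha>" and IH: "set (take i \<alpha>) = {1..?m}"
    using Suc by auto
  have pos: "1 \<le> \<alpha> ! i"
    using bound i by (auto simp: rgf_def asc_seqs_def)
  have le: "\<alpha> ! i \<le> 1 + ?m"
    using bound
  proof
    assume "rgf \<alpha>"
    then have "{1..<\<alpha> ! i} \<subseteq> {1..?m}"
      using i IH by (auto simp: rgf_def)
    then have "Suc ?m \<notin> {1..<\<alpha> ! i}"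
      by (meson atLeastAtMost_iff not_less_eq_eq order_refl subsetD)
    then show ?thesis by auto
  qed (use i in \<open>auto simp: asc_seqs_def\<close>)
  show ?case
  proof (cases "i \<in> d_ascents d \<alpha>")
    case True
    have "x < \<alpha> ! i" if "x \<in> set (take i \<alpha>)" for x
      using that max True i by (auto simp: in_set_conv_nth)
    \<comment> \<open>The first disjunct covers \<open>?m = 0\<close>, where the prefix has no
      maximum to compare with.\<close>
    then have "?m \<notin> {1..?m} \<or> ?m < \<alpha> ! i"
      using IH by auto
    then have "\<alpha> ! i = Suc ?m"
      using le pos by auto
    then show ?thesis
      using True i IH by (auto simp: set_take_Suc asc_take_Suc)
  next
    case False
    then have "i > 0" "\<alpha> ! i + d \<le> \<alpha> ! (i - 1)"
      using i by (auto simp: d_ascents_def)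
    moreover have "\<alpha> ! (i - 1) \<in> set (take i \<alpha>)"
      using \<open>i > 0\<close> i by (auto simp: in_set_conv_nth intro!: exI[of _ "i - 1"])
    ultimately have "\<alpha> ! i \<in> {1..?m}"
      using IH pos by auto
    then show ?thesis
      using False i IH by (simp add: set_take_Suc asc_take_Suc insert_absorb)
  qed
qed

text \<open>Frees the growth bound from \<open>d\<close>: once \<open>d\<close>-ascents are
  left-to-right maxima, their number in a prefix is its largest value.\<close>

lemma self_modified_iff:
  "\<alpha> \<in> self_modified d \<longleftrightarrow> rgf \<alpha> \<and> (\<forall>j\<in>d_ascents d \<alpha>. \<forall>i<j. \<alpha> ! i < \<alpha> ! j)"
proof (cases "\<forall>j\<in>d_ascents d \<alpha>. \<forall>i<j. \<alpha> ! i < \<alpha> ! j")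
  case True
  have "\<alpha> \<in> asc_seqs d \<longleftrightarrow> rgf \<alpha>"
  proof
    assume "\<alpha> \<in> asc_seqs d"
    then show "rgf \<alpha>"
      using set_take_eq_asc[OF True] by (fastforce simp: rgf_def asc_seqs_def)
  next
    assume rgf: "rgf \<alpha>"
    have "1 \<le> \<alpha> ! i \<and> \<alpha> ! i \<le> 1 + asc d (take i \<alpha>)" if i: "i < length \<alpha>" for i
    proof -
      have "\<alpha> ! i \<in> {1..asc d (take (Suc i) \<alpha>)}"
        using set_take_eq_asc[OF True, of "Suc i"] rgf i by (auto simp: set_take_Suc)
      then show ?thesis
        using i by (auto simp: asc_take_Suc split: if_splits)
    qed
    then show "\<alpha> \<in> asc_seqs d"
      by (simp add: asc_seqs_def)
  qed
  then show ?thesis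
    using True by (simp add: self_modified_def hat_fixed_iff)
qed (auto simp: self_modified_def hat_fixed_iff)

text \<open>The gap condition says that no weak descent is a \<open>d\<close>-ascent, so that the
  \<open>d\<close>-ascents are just the ordinary ascents.\<close>

lemma self_modified_iff_0:
  "\<alpha> \<in> self_modified d \<longleftrightarrow> \<alpha> \<in> self_modified 0 \<and>
     (\<forall>p. Suc p < length \<alpha> \<and> \<alpha> ! Suc p \<le> \<alpha> ! p \<longrightarrow> \<alpha> ! Suc p + d \<le> \<alpha> ! p)"
  (is "_ \<longleftrightarrow> _ \<and> ?gap")
proof
  assume \<alpha>: "\<alpha> \<in> self_modified d"
  have "d_ascents 0 \<alpha> \<subseteq> d_ascents d \<alpha>"
    by (auto simp: d_ascents_def)
  moreover have ?gap
  proof (intro allI impI)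
    fix p assume p: "Suc p < length \<alpha> \<and> \<alpha> ! Suc p \<le> \<alpha> ! p"
    then have "Suc p \<notin> d_ascents d \<alpha>"
      using \<alpha> unfolding self_modified_iff by (meson lessI not_le)
    then show "\<alpha> ! Suc p + d \<le> \<alpha> ! p"
      using p by (simp add: d_ascents_def)
  qed
  ultimately show "\<alpha> \<in> self_modified 0 \<and> ?gap"
    using \<alpha> by (auto simp: self_modified_iff)
next
  assume \<alpha>: "\<alpha> \<in> self_modified 0 \<and> ?gap"
  have "j \<in> d_ascents 0 \<alpha>" if j: "j \<in> d_ascents d \<alpha>" for j
  proof (cases j)
    case 0
    then show ?thesis using j by (simp add: d_ascents_def)
  next
    case (Suc p)
    then show ?thesis
      using j \<alpha> by (fastforce simp: d_ascents_def)
  qed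
  then show "\<alpha> \<in> self_modified d"
    using \<alpha> by (auto simp: self_modified_iff)
qed

section \<open>The Burge transpose as a sorted list\<close>

text \<open>The order in which the Burge transpose of \<open>\<alpha>\<close> lists the positions, which start at 1.\<close>

definition burge_less :: "nat list \<Rightarrow> nat \<Rightarrow> nat \<Rightarrow> bool" where
  "burge_less \<alpha> x y \<longleftrightarrow>
     \<alpha> ! (x - 1) < \<alpha> ! (y - 1) \<or> \<alpha> ! (x - 1) = \<alpha> ! (y - 1) \<and> y < x"

lemma sorted_wrt_concat_map:
  assumes "sorted_wrt R js"
    and "\<And>j. j \<in> set js \<Longrightarrow> sorted_wrt P (f j)"
    and "\<And>i j x y. R i j \<Longrightarrow> x \<in> set (f i) \<Longrightarrow> y \<in> set (f j) \<Longrightarrow> P x y"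
  shows "sorted_wrt P (concat (map f js))"
  using assms by (induction js) (auto simp: sorted_wrt_append)

lemma set_burge: "set (burge \<alpha>) = {1..length \<alpha>}"
proof -
  have "set (burge \<alpha>) = Suc ` {0..<length \<alpha>}"
    by (fastforce simp: burge_def)
  also have "\<dots> = {1..length \<alpha>}"
    by (simp add: atLeastLessThanSuc_atLeastAtMost)
  finally show ?thesis .
qed

lemma sorted_wrt_burge: "sorted_wrt (burge_less \<alpha>) (burge \<alpha>)"
  unfolding burge_def
proof (rule sorted_wrt_concat_map)
  show "sorted_wrt (<) (sorted_list_of_set (set \<alpha>))"
    by (rule strict_sorted_list_of_set)
next
  fix v
  have "sorted_wrt (<) (filter (\<lambda>i. \<alpha> ! i = v) [0..<length \<alpha>])"
    by (intro sorted_wrt_filter) simp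
  then show "sorted_wrt (burge_less \<alpha>)
      (rev (map Suc (filter (\<lambda>i. \<alpha> ! i = v) [0..<length \<alpha>])))"
    \<comment> \<open>Inside one block the values agree, so only the reversed order of the positions
      matters.\<close>
    unfolding sorted_wrt_rev sorted_wrt_map
    by (rule sorted_wrt_mono_rel[rotated]) (auto simp: burge_less_def)
qed (auto simp: burge_less_def)

lemma burge_nth_less:
  "i < j \<Longrightarrow> j < length (burge \<alpha>) \<Longrightarrow> burge_less \<alpha> (burge \<alpha> ! i) (burge \<alpha> ! j)"
  using sorted_wrt_burge by (simp add: sorted_wrt_iff_nth_less)

lemma burge_nth_less_iff:
  assumes "i < length (burge \<alpha>)" "j < length (burge \<alpha>)"
  shows "burge_less \<alpha> (burge \<alpha> ! i) (burge \<alpha> ! j) \<longleftrightarrow> i < j"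
  using burge_nth_less[of i j \<alpha>] burge_nth_less[of j i \<alpha>] assms
  by (cases i j rule: linorder_cases) (auto simp: burge_less_def)

text \<open>Neighbours in the transpose have no position between them in the order
  \<open>burge_less\<close>; restricted growth would supply one if a value were skipped or if a
  value increase came with \<open>y \<le> x\<close>.\<close>

lemma burge_consecutive:
  assumes rgf: "rgf \<alpha>" and t: "Suc t < length (burge \<alpha>)"
  defines "x \<equiv> burge \<alpha> ! t" and "y \<equiv> burge \<alpha> ! Suc t"
  shows "\<alpha> ! (y - 1) = \<alpha> ! (x - 1) + (if x < y then 1 else 0)"
proof -
  have xy: "burge_less \<alpha> x y"
    unfolding x_def y_def using t by (intro burge_nth_less) auto
  have "x \<in> set (burge \<alpha>)" "y \<in> set (burge \<alpha>)"
    using t by (simp_all add: x_def y_def)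
  then have x: "1 \<le> x" "x \<le> length \<alpha>" and y: "1 \<le> y" "y \<le> length \<alpha>"
    by (auto simp: set_burge)
  have no_between: "\<not> (burge_less \<alpha> x z \<and> burge_less \<alpha> z y)" if z: "z \<in> {1..length \<alpha>}" for z
  proof -
    obtain m where "m < length (burge \<alpha>)" "burge \<alpha> ! m = z"
      using z set_burge[of \<alpha>] by (metis in_set_conv_nth)
    then show ?thesis
      using burge_nth_less_iff[of t \<alpha> m] burge_nth_less_iff[of m \<alpha> "Suc t"] t
      by (auto simp: x_def y_def)
  qed
  have smaller: "\<exists>z \<in> {1..length \<alpha>}. z < y \<and> \<alpha> ! (z - 1) = c"
    if c: "1 \<le> c" "c < \<alpha> ! (y - 1)" for c
  proof -
    have "c \<in> set (take (y - 1) \<alpha>)"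
    proof -
      have "y - 1 < length \<alpha>"
        using y by simp
      then have "{1..<\<alpha> ! (y - 1)} \<subseteq> set (take (y - 1) \<alpha>)"
        using rgf unfolding rgf_def by blast
      then show ?thesis
        using c by auto
    qed
    then obtain k where "k < y - 1" "\<alpha> ! k = c"
      by (auto simp: in_set_conv_nth)
    then show ?thesis
      using y by (intro bexI[of _ "Suc k"]) auto
  qed
  consider "\<alpha> ! (x - 1) = \<alpha> ! (y - 1)" "y < x" | "\<alpha> ! (x - 1) < \<alpha> ! (y - 1)"
    using xy by (auto simp: burge_less_def)
  then show ?thesis
  proof cases
    case 2
    \<comment> \<open>An occurrence of a skipped value would be listed between \<open>x\<close> and
      \<open>y\<close>.\<close>
    have "\<not> Suc (\<alpha> ! (x - 1)) < \<alpha> ! (y - 1)"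
    proof
      assume "Suc (\<alpha> ! (x - 1)) < \<alpha> ! (y - 1)"
      with smaller[of "Suc (\<alpha> ! (x - 1))"] obtain z
        where z: "z \<in> {1..length \<alpha>}" "\<alpha> ! (z - 1) = Suc (\<alpha> ! (x - 1))" by auto
      with \<open>Suc (\<alpha> ! (x - 1)) < \<alpha> ! (y - 1)\<close> no_between[OF z(1)] show False
        by (simp add: burge_less_def)
    qed
    \<comment> \<open>The value at \<open>x\<close> also occurs at some \<open>z < y\<close>. If
      \<open>z < x\<close>, then \<open>z\<close> would be listed between \<open>x\<close> and
      \<open>y\<close>; hence \<open>x \<le> z < y\<close>.\<close>
    moreover have "x < y"
    proof -
      have "1 \<le> \<alpha> ! (x - 1)"
        using rgf x by (auto simp: rgf_def)
      with smaller[of "\<alpha> ! (x - 1)"] 2 obtain z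
        where z: "z \<in> {1..length \<alpha>}" "z < y" "\<alpha> ! (z - 1) = \<alpha> ! (x - 1)" by auto
      then show ?thesis
        using no_between[OF z(1)] 2 by (auto simp: burge_less_def)
    qed
    ultimately show ?thesis
      using 2 by auto
  qed simp
qed

section \<open>Ascents of factors and the forbidden pattern\<close>

text \<open>Each ascent after the first letter raises the value by one and each descent keeps it;
  \<open>Suc\<close> accounts for the first letter, which always counts.\<close>

lemma asc_burge_factor:
  assumes "rgf \<alpha>" "i \<le> j" "j < length (burge \<alpha>)"
  shows "asc 0 (take (Suc j - i) (drop i (burge \<alpha>))) + \<alpha> ! (burge \<alpha> ! i - 1)
       = Suc (\<alpha> ! (burge \<alpha> ! j - 1))"
  using assms(2,3)
proof (induction j rule: dec_induct)
  case base
  then have "take (Suc i - i) (drop i (burge \<alpha>)) = [] @ [burge \<alpha> ! i]"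
    by (simp add: Suc_diff_le take_Suc_conv_app_nth)
  then show ?case
    using asc_snoc[of 0 "[]"] by (simp add: asc_def d_ascents_def)
next
  case (step j)
  let ?F = "take (Suc j - i) (drop i (burge \<alpha>))"
  have "take (Suc (Suc j) - i) (drop i (burge \<alpha>)) = ?F @ [burge \<alpha> ! Suc j]"
    using step.hyps step.prems by (simp add: Suc_diff_le take_Suc_conv_app_nth)
  moreover have "?F \<noteq> []" "last ?F = burge \<alpha> ! j"
    using step.hyps step.prems by (auto simp: last_conv_nth)
  moreover have "asc 0 ?F + \<alpha> ! (burge \<alpha> ! i - 1) = Suc (\<alpha> ! (burge \<alpha> ! j - 1))"
    using step by simp
  ultimately show ?case
    using burge_consecutive[OF \<open>rgf \<alpha>\<close>, of j] step.prems by (simp add: asc_snoc)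
qed

lemma contains_s_burge_iff:
  assumes "rgf \<alpha>"
  shows "contains_s d (burge \<alpha>) \<longleftrightarrow>
    (\<exists>p. Suc p < length \<alpha> \<and> \<alpha> ! Suc p \<le> \<alpha> ! p \<and> \<alpha> ! p < \<alpha> ! Suc p + d)"
proof
  assume "contains_s d (burge \<alpha>)"
  then obtain i j where ij: "i < j" "j < length (burge \<alpha>)" "burge \<alpha> ! i = burge \<alpha> ! j + 1"
    and asc: "asc 0 (take (Suc j - i) (drop i (burge \<alpha>))) \<le> d"
    by (auto simp: contains_s_def)
  have "burge \<alpha> ! i \<in> {1..length \<alpha>}" "burge \<alpha> ! j \<in> {1..length \<alpha>}"
    using ij set_burge[of \<alpha>] by (metis less_trans nth_mem)+
  \<comment> \<open>Letters count from 1: \<open>Suc (Suc p)\<close> and \<open>Suc p\<close> stand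
    for the list indices \<open>Suc p\<close> and \<open>p\<close>.\<close>
  then obtain p where p: "burge \<alpha> ! j = Suc p" "Suc p < length \<alpha>"
    using ij by (cases "burge \<alpha> ! j") auto
  have "\<alpha> ! Suc p \<le> \<alpha> ! p"
    using burge_nth_less[OF ij(1,2)] ij p by (auto simp: burge_less_def)
  moreover have "\<alpha> ! p < \<alpha> ! Suc p + d"
    using asc_burge_factor[OF assms, of i j] asc ij p by auto
  ultimately show "\<exists>p. Suc p < length \<alpha> \<and> \<alpha> ! Suc p \<le> \<alpha> ! p \<and> \<alpha> ! p < \<alpha> ! Suc p + d"
    using p by blast
next
  assume "\<exists>p. Suc p < length \<alpha> \<and> \<alpha> ! Suc p \<le> \<alpha> ! p \<and> \<alpha> ! p < \<alpha> ! Suc p + d"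
  then obtain p where p: "Suc p < length \<alpha>" "\<alpha> ! Suc p \<le> \<alpha> ! p" "\<alpha> ! p < \<alpha> ! Suc p + d"
    by blast
  then have "Suc p \<in> set (burge \<alpha>)" "Suc (Suc p) \<in> set (burge \<alpha>)"
    by (auto simp: set_burge)
  then obtain i j where i: "i < length (burge \<alpha>)" "burge \<alpha> ! i = Suc (Suc p)"
    and j: "j < length (burge \<alpha>)" "burge \<alpha> ! j = Suc p"
    by (auto simp: in_set_conv_nth)
  \<comment> \<open>The larger position comes first because its value is smaller or equal.\<close>
  have "i < j"
    using burge_nth_less_iff[OF i(1) j(1)] i j p by (auto simp: burge_less_def)
  moreover from this have "asc 0 (take (Suc j - i) (drop i (burge \<alpha>))) \<le> d"
    using asc_burge_factor[OF assms, of i j] i j p by auto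
  ultimately show "contains_s d (burge \<alpha>)"
    unfolding contains_s_def using i j by (intro exI[of _ i] exI[of _ j]) simp
qed

lemma SMF_eq: "SMF d = burge ` self_modified d"
  by (auto simp: SMF_def \<Phi>_def self_modified_def)

theorem theorem5p2:
  fixes d :: nat
  shows "SMF d = {\<pi> \<in> SMF 0. \<not> contains_s d \<pi>}"
proof -
  \<comment> \<open>The added condition depends on \<alpha> only through
    \<open>burge \<alpha>\<close>, so it carries over to the images.\<close>
  have "\<alpha> \<in> self_modified d \<longleftrightarrow> \<alpha> \<in> self_modified 0 \<and> \<not> contains_s d (burge \<alpha>)" for \<alpha>
    using self_modified_iff_0[of \<alpha> d] contains_s_burge_iff[of \<alpha> d] self_modified_iff[of \<alpha> 0]
    by (meson not_less)
  then show ?thesis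
    unfolding SMF_eq by blast
qed

end
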